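(* Let $\mathbf{x}\in\mathbb{R}^d$ be a sample value of $\mathbf{X}$ and, for each $k=2,\dots,K$, let $\pi_{j,k}\in\boldsymbol{\pi}_k$ be the index of the explanatory variable used for block $k$ (the position $j$ may depend on $k$). Assume that: (A2) the joint (resp. marginal) CDF is continuous and has a density function $\rho>0$ on its open support; (A3) each component of the dependency function $r_{\pi_{j,k}}$ is differentiable with respect to $X_{\pi_{j,k}}$; (A4) the function $f:\mathbb{R}^d\to\mathbb{R}$ is differentiable with respect to each input. Then: (i) for all $k\in\{2,\dots,K\}$, the actual Jacobian matrix $\frac{\partial_a\mathbf{X}_{\boldsymbol{\pi}_k}}{\partial\mathbf{x}_{\boldsymbol{\pi}_k}}$ is the $d_k\times d_k$ matrix $$J^a_{\boldsymbol{\pi}_k}(\mathbf{x}_{\boldsymbol{\pi}_k})=\left[\frac{J^{(\pi_{j,k})}(\mathbf{x}_{\boldsymbol{\pi}_k})}{J_1^{(\pi_{j,k})}(\mathbf{x}_{\boldsymbol{\pi}_k})}\ \cdots\ \frac{J^{(\pi_{j,k})}(\mathbf{x}_{\boldsymbol{\pi}_k})}{J_{d_k}^{(\pi_{j,k})}(\mathbf{x}_{\boldsymbol{\pi}_k})}\right];$$ (ii) the actual Jacobian matrix $\frac{\partial_a\mathbf{X}}{\partial\mathbf{x}}$ is the block-diagonal matrix $$J^a(\mathbf{x})=\begin{bmatrix}\mathcal{I}_{d_1\times d_1}&0&\cdots&0\\0&J^a_{\boldsymbol{\pi}_2}(\mathbf{x}_{\boldsymbol{\pi}_2})&\cdots&0\\\vdots&\vdots&\ddots&\vdots\\0&0&\cdots&J^a_{\boldsymbol{\pi}_K}(\mathbf{x}_{\boldsymbol{\pi}_K})\end{bmatrix};$$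 (iii) the actual partial derivatives of $f$ are given by $$\frac{\partial_a f}{\partial\mathbf{x}}(\mathbf{x})=J^a(\mathbf{x})^{T}\,\nabla f(\mathbf{x}).$$
   Context: $\mathbf{X}=(X_1,\dots,X_d)$ is a random vector of continuous variables with joint CDF $F$, made of independent blocks $\mathbf{X}_{\boldsymbol{\pi}_1},\dots,\mathbf{X}_{\boldsymbol{\pi}_K}$, where $\boldsymbol{\pi}_1,\dots,\boldsymbol{\pi}_K$ is a partition of $\{1,\dots,d\}$, $\mathbf{X}_{\boldsymbol{\pi}_k}=(X_i)_{i\in\boldsymbol{\pi}_k}$ and $d_k=|\boldsymbol{\pi}_k|$. The block $\mathbf{X}_{\boldsymbol{\pi}_1}$ consists of $d_1\ge 0$ independent variables; for $k\ge 2$ the block $\mathbf{X}_{\boldsymbol{\pi}_k}$ consists of $d_k\ge2$ dependent variables. Write $\boldsymbol{\pi}_k=\{\pi_{1,k}<\dots<\pi_{d_k,k}\}$ and $(\sim\pi_{j,k})=(\pi_{1,k},\dots,\pi_{j-1,k},\pi_{j+1,k},\dots,\pi_{d_k,k})$. Vectors and matrices are indexed with the coordinates ordered block by block. $\mathcal{I}$ is the identity matrix. For $k\ge2$, the dependency model of $\mathbf{X}_{\boldsymbol{\pi}_k}$ with explanatory variable $X_{\pi_{j,k}}$ is $\mathbf{X}_{\sim\pi_{j,k}}=r_{\pi_{j,k}}(X_{\pi_{j,k}},\mathbf{Z}_k)$, where $\mathbf{Z}_k$ is a vector of $d_k-1$ independent variables, independent of $X_{\pi_{j,k}}$; its components are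 $r_{\pi_{i,k}}$, $i\neq j$, so $X_{\pi_{i,k}}=r_{\pi_{i,k}}(X_{\pi_{j,k}},\mathbf{Z}_k)$. For given $x_{\pi_{j,k}}$ the map $\mathbf{z}\mapsto r_{\pi_{j,k}}(x_{\pi_{j,k}},\mathbf{z})$ has a unique inverse $r_{\pi_{j,k}}^{-1}(\cdot\mid x_{\pi_{j,k}})$. The partial derivatives of $\mathbf{X}_{\boldsymbol{\pi}_k}$ with respect to $X_{\pi_{j,k}}$ at $\mathbf{x}_{\boldsymbol{\pi}_k}$ form the vector $$J^{(\pi_{j,k})}(\mathbf{x}_{\boldsymbol{\pi}_k})=\left[\frac{\partial r_{\pi_{1,k}}}{\partial x_{\pi_{j,k}}}\ \cdots\ \underbrace{1}_{j\text{th}}\ \cdots\ \frac{\partial r_{\pi_{d_k,k}}}{\partial x_{\pi_{j,k}}}\right]^{T}\left(x_{\pi_{j,k}},r_{\pi_{j,k}}^{-1}(\mathbf{x}_{\sim\pi_{j,k}}\mid x_{\pi_{j,k}})\right),$$ with $i$-th component $J_i^{(\pi_{j,k})}=\frac{\partial X_{\pi_{i,k}}}{\partial x_{\pi_{j,k}}}$. $\nabla f$ is the formal (Euclidean) gradient of $f$, i.e. the vector of ordinary partial derivatives $f'_{x_i}$ obtained by holding the other inputs constant, ordered by blocks. Actual derivatives are those obtained by using, in each block $k\ge2$, only the single dependency function with explanatory variable $X_{\pi_{j,k}}$, together with the reciprocal rule $\frac{\partial X_{\pi_{j,k}}}{\partial x_{\pi_{i,k}}}=1\big/\frac{\partial X_{\pi_{i,k}}}{\partial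 x_{\pi_{j,k}}}$ and the chain rule $\frac{\partial X_{\pi_{i_1,k}}}{\partial x_{\pi_{i_2,k}}}=\frac{\partial X_{\pi_{i_1,k}}}{\partial x_{\pi_{j,k}}}\frac{\partial X_{\pi_{j,k}}}{\partial x_{\pi_{i_2,k}}}$ (wherever these quotients are defined). Derivatives of a variable of one block with respect to a variable of another block are zero, and within block $1$ they are $1$ for the same variable and $0$ otherwise. The actual Jacobian $\frac{\partial_a\mathbf{X}_{\boldsymbol{\pi}_k}}{\partial\mathbf{x}_{\boldsymbol{\pi}_k}}$ (resp. $\frac{\partial_a\mathbf{X}}{\partial\mathbf{x}}$) is the matrix whose $(p,q)$ entry is the actual derivative of the $p$-th variable with respect to the $q$-th variable of $\mathbf{X}_{\boldsymbol{\pi}_k}$ (resp. of $\mathbf{X}$). The actual partial derivative of $f$ with respect to $x_q$ is the chain-rule derivative $\sum_{p=1}^d f'_{x_p}(\mathbf{x})\,\frac{\partial_a X_p}{\partial x_q}$. *)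

theory Defs
  imports "HOL-Probability.Probability" "Jordan_Normal_Form.Matrix"
begin

text \<open>A vector indexed by a finite set \<open>I\<close> of naturals is a function that is extensional on \<open>I\<close>,
  i.e. a point of \<open>PiM I (\<lambda>_. borel)\<close>; in particular \<open>\<real>\<^sup>d\<close> is \<open>{1..d} \<rightarrow>\<^sub>E UNIV\<close>.
  Only the vectors and matrices of derivatives, whose coordinates are ordered block by block, are
  \<open>Matrix.vec\<close> and \<open>Matrix.mat\<close> objects; positions in these count from 0.\<close>

definition rvec :: "nat set \<Rightarrow> (nat \<Rightarrow> 'w \<Rightarrow> real) \<Rightarrow> 'w \<Rightarrow> (nat \<Rightarrow> real)" where
  "rvec I X \<omega> = (\<lambda>i\<in>I. X i \<omega>)"

definition joint_cdf :: "'w measure \<Rightarrow> nat set \<Rightarrow> (nat \<Rightarrow> 'w \<Rightarrow> real) \<Rightarrow> (nat \<Rightarrow> real) \<Rightarrow> real" where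
  "joint_cdf M I X y = measure M {\<omega> \<in> space M. \<forall>i\<in>I. X i \<omega> \<le> y i}"

definition continuous_cdf_pos_density :: "'w measure \<Rightarrow> nat set \<Rightarrow> (nat \<Rightarrow> 'w \<Rightarrow> real) \<Rightarrow> bool" where
  "continuous_cdf_pos_density M I X \<longleftrightarrow>
     continuous_map (product_topology (\<lambda>_. euclideanreal) I) euclideanreal (joint_cdf M I X) \<and>
     (\<exists>\<rho> S. distributed M (PiM I (\<lambda>_. lborel)) (rvec I X) (\<lambda>y. ennreal (\<rho> y)) \<and>
            openin (product_topology (\<lambda>_. euclideanreal) I) S \<and>
            (\<forall>y\<in>S. 0 < \<rho> y) \<and>
            (\<forall>y\<in>(I \<rightarrow>\<^sub>E UNIV) - S. \<rho> y = 0))"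

definition block_partition :: "nat \<Rightarrow> nat \<Rightarrow> (nat \<Rightarrow> nat set) \<Rightarrow> bool" where
  "block_partition d K \<pi> \<longleftrightarrow>
     1 \<le> K \<and> (\<Union>k\<in>{1..K}. \<pi> k) = {1..d} \<and> disjoint_family_on \<pi> {1..K} \<and>
     (\<forall>k\<in>{2..K}. 2 \<le> card (\<pi> k))"

definition block_list :: "(nat \<Rightarrow> nat set) \<Rightarrow> nat \<Rightarrow> nat list" where
  "block_list \<pi> k = sorted_list_of_set (\<pi> k)"

definition coord_list :: "nat \<Rightarrow> (nat \<Rightarrow> nat set) \<Rightarrow> nat list" where
  "coord_list K \<pi> = concat (map (block_list \<pi>) [1..<Suc K])"

definition block_of :: "nat \<Rightarrow> (nat \<Rightarrow> nat set) \<Rightarrow> nat \<Rightarrow> nat" where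
  "block_of K \<pi> i = (THE k. k \<in> {1..K} \<and> i \<in> \<pi> k)"

text \<open>In block \<open>k\<close> the explanatory variable has index \<open>e k\<close>. The component \<open>r i\<close>, for \<open>i\<close> in
  \<open>\<pi> k - {e k}\<close>, takes the value of the explanatory variable and that of the vector \<open>Z k\<close>.
  The set \<open>D k\<close> is the set of values of \<open>Z k\<close>; the dependency function is inverted on it.\<close>

definition dep_fun ::
  "(nat \<Rightarrow> nat set) \<Rightarrow> (nat \<Rightarrow> nat) \<Rightarrow> (nat \<Rightarrow> real \<Rightarrow> (nat \<Rightarrow> real) \<Rightarrow> real) \<Rightarrow>
   nat \<Rightarrow> real \<Rightarrow> (nat \<Rightarrow> real) \<Rightarrow> (nat \<Rightarrow> real)" where
  "dep_fun \<pi> e r k t z = (\<lambda>i\<in>\<pi> k - {e k}. r i t z)"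

definition dep_inv ::
  "(nat \<Rightarrow> nat set) \<Rightarrow> (nat \<Rightarrow> nat) \<Rightarrow> (nat \<Rightarrow> real \<Rightarrow> (nat \<Rightarrow> real) \<Rightarrow> real) \<Rightarrow>
   (nat \<Rightarrow> (nat \<Rightarrow> real) set) \<Rightarrow> nat \<Rightarrow> (nat \<Rightarrow> real) \<Rightarrow> real \<Rightarrow> (nat \<Rightarrow> real)" where
  "dep_inv \<pi> e r D k y t = the_inv_into (D k) (dep_fun \<pi> e r k t) y"

definition dep_deriv ::
  "(nat \<Rightarrow> nat set) \<Rightarrow> (nat \<Rightarrow> nat) \<Rightarrow> (nat \<Rightarrow> real \<Rightarrow> (nat \<Rightarrow> real) \<Rightarrow> real) \<Rightarrow>
   (nat \<Rightarrow> (nat \<Rightarrow> real) set) \<Rightarrow> (nat \<Rightarrow> real) \<Rightarrow> nat \<Rightarrow> nat \<Rightarrow> real" where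
  "dep_deriv \<pi> e r D x k i =
     (if i = e k then 1
      else deriv (\<lambda>t. r i t (dep_inv \<pi> e r D k (restrict x (\<pi> k - {e k})) (x (e k)))) (x (e k)))"

definition dep_deriv_vec ::
  "(nat \<Rightarrow> nat set) \<Rightarrow> (nat \<Rightarrow> nat) \<Rightarrow> (nat \<Rightarrow> real \<Rightarrow> (nat \<Rightarrow> real) \<Rightarrow> real) \<Rightarrow>
   (nat \<Rightarrow> (nat \<Rightarrow> real) set) \<Rightarrow> (nat \<Rightarrow> real) \<Rightarrow> nat \<Rightarrow> real Matrix.vec" where
  "dep_deriv_vec \<pi> e r D x k =
     Matrix.vec (card (\<pi> k)) (\<lambda>a. dep_deriv \<pi> e r D x k (block_list \<pi> k ! a))"

text \<open>The actual derivative of the variable \<open>p\<close> with respect to the variable \<open>q\<close>. Within a block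
  \<open>k \<ge> 2\<close> the three branches are the derivative of the dependency function, the reciprocal rule,
  and the chain rule through the explanatory variable. A quotient with denominator 0 is undefined
  in the mathematics and has the value 0 here.\<close>

definition actual_deriv ::
  "nat \<Rightarrow> (nat \<Rightarrow> nat set) \<Rightarrow> (nat \<Rightarrow> nat) \<Rightarrow> (nat \<Rightarrow> real \<Rightarrow> (nat \<Rightarrow> real) \<Rightarrow> real) \<Rightarrow>
   (nat \<Rightarrow> (nat \<Rightarrow> real) set) \<Rightarrow> (nat \<Rightarrow> real) \<Rightarrow> nat \<Rightarrow> nat \<Rightarrow> real" where
  "actual_deriv K \<pi> e r D x p q =
     (let k = block_of K \<pi> q in
      if block_of K \<pi> p \<noteq> k then 0
      else if k = 1 then (if p = q then 1 else 0)
      else if q = e k then dep_deriv \<pi> e r D x k p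
      else if p = e k then 1 / dep_deriv \<pi> e r D x k q
      else dep_deriv \<pi> e r D x k p * (1 / dep_deriv \<pi> e r D x k q))"

definition actual_jacobian_block ::
  "nat \<Rightarrow> (nat \<Rightarrow> nat set) \<Rightarrow> (nat \<Rightarrow> nat) \<Rightarrow> (nat \<Rightarrow> real \<Rightarrow> (nat \<Rightarrow> real) \<Rightarrow> real) \<Rightarrow>
   (nat \<Rightarrow> (nat \<Rightarrow> real) set) \<Rightarrow> (nat \<Rightarrow> real) \<Rightarrow> nat \<Rightarrow> real mat" where
  "actual_jacobian_block K \<pi> e r D x k =
     mat (card (\<pi> k)) (card (\<pi> k))
       (\<lambda>(a, b). actual_deriv K \<pi> e r D x (block_list \<pi> k ! a) (block_list \<pi> k ! b))"

definition actual_jacobian ::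
  "nat \<Rightarrow> nat \<Rightarrow> (nat \<Rightarrow> nat set) \<Rightarrow> (nat \<Rightarrow> nat) \<Rightarrow> (nat \<Rightarrow> real \<Rightarrow> (nat \<Rightarrow> real) \<Rightarrow> real) \<Rightarrow>
   (nat \<Rightarrow> (nat \<Rightarrow> real) set) \<Rightarrow> (nat \<Rightarrow> real) \<Rightarrow> real mat" where
  "actual_jacobian d K \<pi> e r D x =
     mat d d (\<lambda>(a, b). actual_deriv K \<pi> e r D x (coord_list K \<pi> ! a) (coord_list K \<pi> ! b))"

definition partial_deriv :: "((nat \<Rightarrow> real) \<Rightarrow> real) \<Rightarrow> nat \<Rightarrow> (nat \<Rightarrow> real) \<Rightarrow> real" where
  "partial_deriv f i x = deriv (\<lambda>t. f (x(i := t))) (x i)"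

definition formal_gradient ::
  "nat \<Rightarrow> nat \<Rightarrow> (nat \<Rightarrow> nat set) \<Rightarrow> ((nat \<Rightarrow> real) \<Rightarrow> real) \<Rightarrow> (nat \<Rightarrow> real) \<Rightarrow> real Matrix.vec" where
  "formal_gradient d K \<pi> f x = Matrix.vec d (\<lambda>a. partial_deriv f (coord_list K \<pi> ! a) x)"

definition actual_partial_deriv ::
  "nat \<Rightarrow> nat \<Rightarrow> (nat \<Rightarrow> nat set) \<Rightarrow> (nat \<Rightarrow> nat) \<Rightarrow> (nat \<Rightarrow> real \<Rightarrow> (nat \<Rightarrow> real) \<Rightarrow> real) \<Rightarrow>
   (nat \<Rightarrow> (nat \<Rightarrow> real) set) \<Rightarrow> ((nat \<Rightarrow> real) \<Rightarrow> real) \<Rightarrow> (nat \<Rightarrow> real) \<Rightarrow> nat \<Rightarrow> real" where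
  "actual_partial_deriv d K \<pi> e r D f x q =
     (\<Sum>p = 1..d. partial_deriv f p x * actual_deriv K \<pi> e r D x p q)"

definition actual_gradient ::
  "nat \<Rightarrow> nat \<Rightarrow> (nat \<Rightarrow> nat set) \<Rightarrow> (nat \<Rightarrow> nat) \<Rightarrow> (nat \<Rightarrow> real \<Rightarrow> (nat \<Rightarrow> real) \<Rightarrow> real) \<Rightarrow>
   (nat \<Rightarrow> (nat \<Rightarrow> real) set) \<Rightarrow> ((nat \<Rightarrow> real) \<Rightarrow> real) \<Rightarrow> (nat \<Rightarrow> real) \<Rightarrow> real Matrix.vec" where
  "actual_gradient d K \<pi> e r D f x =
     Matrix.vec d (\<lambda>b. actual_partial_deriv d K \<pi> e r D f x (coord_list K \<pi> ! b))"

text \<open>The closed-form matrices \<open>J\<^sup>a\<close> of a block and of the whole vector.\<close>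

definition Ja_block ::
  "(nat \<Rightarrow> nat set) \<Rightarrow> (nat \<Rightarrow> nat) \<Rightarrow> (nat \<Rightarrow> real \<Rightarrow> (nat \<Rightarrow> real) \<Rightarrow> real) \<Rightarrow>
   (nat \<Rightarrow> (nat \<Rightarrow> real) set) \<Rightarrow> (nat \<Rightarrow> real) \<Rightarrow> nat \<Rightarrow> real mat" where
  "Ja_block \<pi> e r D x k =
     (let J = dep_deriv_vec \<pi> e r D x k
      in mat_of_cols (card (\<pi> k))
           (map (\<lambda>b. (1 / vec_index J b) \<cdot>\<^sub>v J) [0..<card (\<pi> k)]))"

definition Ja ::
  "nat \<Rightarrow> (nat \<Rightarrow> nat set) \<Rightarrow> (nat \<Rightarrow> nat) \<Rightarrow> (nat \<Rightarrow> real \<Rightarrow> (nat \<Rightarrow> real) \<Rightarrow> real) \<Rightarrow>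
   (nat \<Rightarrow> (nat \<Rightarrow> real) set) \<Rightarrow> (nat \<Rightarrow> real) \<Rightarrow> real mat" where
  "Ja K \<pi> e r D x =
     diag_block_mat (1\<^sub>m (card (\<pi> 1)) # map (Ja_block \<pi> e r D x) [2..<Suc K])"

end

theory Submission
  imports Defs
begin

text \<open>Since the explanatory component of \<open>J\<close> is 1, the direct derivative, the reciprocal rule and
  the chain rule are all instances of the one formula \<open>J\<^sub>p / J\<^sub>q\<close>. In the junk case \<open>J\<^sub>q = 0\<close>
  both sides are 0.\<close>

text \<open>Induction on the list of blocks, peeling off the first one: a position in the
  concatenation either falls inside \<open>L k\<close> or belongs, after a shift by
  \<open>length (L k)\<close>, to the remaining blocks. This splits the matrix into the four blocks
  of the recursion of \<open>diag_block_mat\<close>.\<close>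

lemma mat_concat_eq_diag_block_mat:
  assumes "distinct ks"
    and "\<And>k l p q. k \<in> set ks \<Longrightarrow> l \<in> set ks \<Longrightarrow> k \<noteq> l \<Longrightarrow> p \<in> set (L k) \<Longrightarrow> q \<in> set (L l) \<Longrightarrow>
           A p q = (0 :: 'a :: zero)"
  shows "mat (length (concat (map L ks))) (length (concat (map L ks)))
           (\<lambda>(a, b). A (concat (map L ks) ! a) (concat (map L ks) ! b)) =
         diag_block_mat (map (\<lambda>k. mat (length (L k)) (length (L k))
           (\<lambda>(a, b). A (L k ! a) (L k ! b))) ks)"
  using assms
proof (induction ks)
  case Nil
  show ?case by (intro eq_matI) auto
next
  case (Cons k ks)
  let ?c = "concat (map L ks)" and ?l = "L k"
  have IH: "mat (length ?c) (length ?c) (\<lambda>(a, b). A (?c ! a) (?c ! b)) =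
    diag_block_mat (map (\<lambda>k. mat (length (L k)) (length (L k))
      (\<lambda>(a, b). A (L k ! a) (L k ! b))) ks)"
    using Cons.prems by (intro Cons.IH) auto
  \<comment> \<open>Both orders are needed, one for the upper right and one for the lower left
    block. Distinctness of the indices ensures that \<open>q\<close> comes from a block other than
    \<open>k\<close>.\<close>
  have off: "A p q = 0 \<and> A q p = 0" if "p \<in> set ?l" "q \<in> set ?c" for p q
  proof -
    from \<open>q \<in> set ?c\<close> obtain m where m: "m \<in> set ks" "q \<in> set (L m)" by auto
    then have "k \<noteq> m" using Cons.prems(1) by auto
    then show ?thesis using Cons.prems(2) m that(1) by (metis list.set_intros)
  qed
  show ?case
    \<comment> \<open>The induction hypothesis is used backwards, so that the lower right block also
      becomes an entrywise matrix and all four blocks can be compared entry by entry.\<close>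
    by (rule eq_matI)
      (auto simp: IH[symmetric] Let_def four_block_mat_def nth_append off[OF nth_mem nth_mem]
        simp del: length_concat set_concat)
qed

lemma finite_block:
  assumes "block_partition d K \<pi>" "k \<in> {1..K}"
  shows "finite (\<pi> k)"
  using assms finite_subset[of "\<pi> k" "{1..d}"] unfolding block_partition_def by blast

lemma set_block_list:
  assumes "block_partition d K \<pi>" "k \<in> {1..K}"
  shows "set (block_list \<pi> k) = \<pi> k"
  using finite_block[OF assms] by (simp add: block_list_def)

lemma length_block_list: "length (block_list \<pi> k) = card (\<pi> k)"
  by (simp add: block_list_def)

text \<open>Disjointness of the blocks gives the uniqueness that the definite description in
  \<open>block_of\<close> requires.\<close>

lemma block_of_eq:
  assumes "block_partition d K \<pi>" "k \<in> {1..K}" "i \<in> \<pi> k"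
  shows "block_of K \<pi> i = k"
proof -
  have "l = k" if "l \<in> {1..K}" "i \<in> \<pi> l" for l
    using assms that unfolding block_partition_def disjoint_family_on_def by blast
  then show ?thesis unfolding block_of_def using assms(2,3) by blast
qed

lemma set_coord_list:
  assumes "block_partition d K \<pi>"
  shows "set (coord_list K \<pi>) = {1..d}"
proof -
  have "set (coord_list K \<pi>) = (\<Union>k\<in>{1..K}. set (block_list \<pi> k))"
    by (auto simp: coord_list_def atLeastLessThanSuc_atLeastAtMost simp del: upt_Suc)
  also have "\<dots> = (\<Union>k\<in>{1..K}. \<pi> k)"
    using set_block_list[OF assms] by auto
  finally show ?thesis using assms by (simp add: block_partition_def)
qed

lemma length_coord_list:
  assumes "block_partition d K \<pi>"
  shows "length (coord_list K \<pi>) = d"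
proof -
  have "length (coord_list K \<pi>) = (\<Sum>k\<in>{1..K}. card (\<pi> k))"
    by (simp add: coord_list_def length_concat o_def length_block_list interv_sum_list_conv_sum_set_nat
        atLeastLessThanSuc_atLeastAtMost del: upt_Suc)
  also have "\<dots> = card (\<Union>k\<in>{1..K}. \<pi> k)"
    using assms finite_block[OF assms]
    by (intro card_UN_disjoint[symmetric]) (auto simp: block_partition_def disjoint_family_on_def)
  also have "\<dots> = d"
    using assms by (simp add: block_partition_def)
  finally show ?thesis .
qed

text \<open>A list of length \<open>d\<close> whose set has \<open>d\<close> elements cannot repeat
  any of them.\<close>

lemma distinct_coord_list:
  assumes "block_partition d K \<pi>"
  shows "distinct (coord_list K \<pi>)"
  by (rule card_distinct) (simp add: set_coord_list[OF assms] length_coord_list[OF assms])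

lemma actual_deriv_other_block:
  assumes "block_partition d K \<pi>" "k \<in> {1..K}" "l \<in> {1..K}" "k \<noteq> l" "p \<in> \<pi> k" "q \<in> \<pi> l"
  shows "actual_deriv K \<pi> e r D x p q = 0"
  using assms(4) block_of_eq[OF assms(1,2,5)] block_of_eq[OF assms(1,3,6)]
  by (simp add: actual_deriv_def)

lemma actual_deriv_block1:
  assumes "block_partition d K \<pi>" "p \<in> \<pi> 1" "q \<in> \<pi> 1"
  shows "actual_deriv K \<pi> e r D x p q = (if p = q then 1 else 0)"
proof -
  have "1 \<in> {1..K}" using assms(1) by (simp add: block_partition_def)
  then show ?thesis
    using block_of_eq[OF assms(1) _ assms(2)] block_of_eq[OF assms(1) _ assms(3)]
    by (simp add: actual_deriv_def)
qed

lemma actual_deriv_dependent_block: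
  assumes "block_partition d K \<pi>" "k \<in> {2..K}" "p \<in> \<pi> k" "q \<in> \<pi> k"
  shows "actual_deriv K \<pi> e r D x p q = dep_deriv \<pi> e r D x k p / dep_deriv \<pi> e r D x k q"
proof -
  have "k \<in> {1..K}" using assms(2) by simp
  then have "block_of K \<pi> p = k" "block_of K \<pi> q = k"
    using block_of_eq[OF assms(1)] assms(3,4) by auto
  moreover have "dep_deriv \<pi> e r D x k (e k) = 1" by (simp add: dep_deriv_def)
  \<comment> \<open>Since \<open>k\<close> is at least 2, the branch for block 1 is excluded and
    only the three branches of the dependency model remain.\<close>
  ultimately show ?thesis using assms(2) by (auto simp: actual_deriv_def)
qed

text \<open>Column \<open>b\<close> of \<open>Ja_block\<close> is \<open>J\<close> scaled by
  \<open>1 / J_b\<close>, so its entry in row \<open>a\<close> is the quotient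
  \<open>J_a / J_b\<close> found for the actual derivatives.\<close>

lemma actual_jacobian_block_eq_Ja_block:
  assumes "block_partition d K \<pi>" "k \<in> {2..K}"
  shows "actual_jacobian_block K \<pi> e r D x k = Ja_block \<pi> e r D x k"
proof -
  have "block_list \<pi> k ! a \<in> \<pi> k" if "a < card (\<pi> k)" for a
    using set_block_list[OF assms(1), of k] assms(2) that
    by (metis atLeastAtMost_iff length_block_list nth_mem one_le_numeral order_trans)
  then show ?thesis
    by (intro eq_matI)
      (auto simp: actual_jacobian_block_def Ja_block_def Let_def dep_deriv_vec_def mat_of_cols_def
        actual_deriv_dependent_block[OF assms])
qed

lemma actual_jacobian_block1:
  assumes "block_partition d K \<pi>"
  shows "actual_jacobian_block K \<pi> e r D x 1 = 1\<^sub>m (card (\<pi> 1))"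
proof -
  have K: "1 \<in> {1..K}" using assms by (simp add: block_partition_def)
  have "block_list \<pi> 1 ! a \<in> \<pi> 1" if "a < card (\<pi> 1)" for a
    using set_block_list[OF assms K] that by (metis length_block_list nth_mem)
  \<comment> \<open>The actual derivative compares variables, the identity matrix compares
    positions; the two tests agree because the list has no repetitions.\<close>
  moreover have "block_list \<pi> 1 ! a = block_list \<pi> 1 ! b \<longleftrightarrow> a = b"
    if "a < card (\<pi> 1)" "b < card (\<pi> 1)" for a b
    using that by (intro nth_eq_iff_index_eq) (simp_all add: block_list_def)
  ultimately show ?thesis
    by (intro eq_matI) (auto simp: actual_jacobian_block_def actual_deriv_block1[OF assms, simplified])
qed

lemma actual_jacobian_eq_Ja:
  assumes "block_partition d K \<pi>"
  shows "actual_jacobian d K \<pi> e r D x = Ja K \<pi> e r D x"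
proof -
  have K: "1 \<le> K" using assms by (simp add: block_partition_def)
  let ?L = "block_list \<pi>" and ?A = "actual_deriv K \<pi> e r D x"
  have "actual_jacobian d K \<pi> e r D x =
      diag_block_mat (map (\<lambda>k. mat (length (?L k)) (length (?L k))
        (\<lambda>(a, b). ?A (?L k ! a) (?L k ! b))) [1..<Suc K])"
    \<comment> \<open>Writing the dimension \<open>d\<close> as the length of the concatenated list
      brings the Jacobian into the form of the general block-diagonal lemma.\<close>
    unfolding actual_jacobian_def length_coord_list[OF assms, symmetric] coord_list_def
  proof (rule mat_concat_eq_diag_block_mat)
    fix k l p q
    assume "k \<in> set [1..<Suc K]" "l \<in> set [1..<Suc K]" "k \<noteq> l" "p \<in> set (?L k)" "q \<in> set (?L l)"
    moreover from this have "k \<in> {1..K}" "l \<in> {1..K}" by auto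
    ultimately show "?A p q = 0"
      using actual_deriv_other_block[OF assms] set_block_list[OF assms] by metis
  qed simp
  also have "\<dots> = diag_block_mat (map (actual_jacobian_block K \<pi> e r D x) [1..<Suc K])"
    by (simp only: actual_jacobian_block_def[abs_def] length_block_list)
  \<comment> \<open>Block 1 is split off because it contributes an identity matrix, while the
    quotient formula covers the blocks from 2 on. It always exists, as \<open>1 \<le> K\<close>, but
    may be empty.\<close>
  also have "[1..<Suc K] = 1 # [2..<Suc K]"
    using K by (simp add: upt_conv_Cons numeral_2_eq_2 del: upt_Suc)
  also have "map (actual_jacobian_block K \<pi> e r D x) (1 # [2..<Suc K]) =
      1\<^sub>m (card (\<pi> 1)) # map (Ja_block \<pi> e r D x) [2..<Suc K]"
    using actual_jacobian_block_eq_Ja_block[OF assms]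
    by (simp add: actual_jacobian_block1[OF assms, simplified] del: upt_Suc)
  finally show ?thesis by (simp add: Ja_def)
qed

text \<open>The chain rule sums over variables \<open>1..d\<close>, the matrix product over
  positions \<open>0..<d\<close> in block order. \<open>coord_list\<close> is a bijection from
  positions to variables, so the sums agree; the transpose appears because the summation runs over
  the row index of the Jacobian.\<close>

lemma actual_gradient_eq:
  assumes "block_partition d K \<pi>"
  shows "actual_gradient d K \<pi> e r D f x =
    transpose_mat (actual_jacobian d K \<pi> e r D x) *\<^sub>v formal_gradient d K \<pi> f x"
proof -
  let ?c = "coord_list K \<pi>"
  have "bij_betw ((!) ?c) {0..<d} {1..d}"
    by (rule bij_betw_nth)
      (use assms in \<open>auto simp: distinct_coord_list set_coord_list length_coord_list\<close>)
  then have "(\<Sum>p = 1..d. g p) = (\<Sum>a = 0..<d. g (?c ! a))" for g :: "nat \<Rightarrow> real"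
    by (rule sum.reindex_bij_betw[symmetric])
  then show ?thesis
    by (intro eq_vecI)
      (auto simp: actual_gradient_def actual_partial_deriv_def actual_jacobian_def
        formal_gradient_def scalar_prod_def mult.commute)
qed

theorem theorem2:
  fixes M :: "'w measure" and d K :: nat and \<pi> :: "nat \<Rightarrow> nat set"
    and X :: "nat \<Rightarrow> 'w \<Rightarrow> real" and Z :: "nat \<Rightarrow> nat \<Rightarrow> 'w \<Rightarrow> real"
    and e :: "nat \<Rightarrow> nat" and r :: "nat \<Rightarrow> real \<Rightarrow> (nat \<Rightarrow> real) \<Rightarrow> real"
    and D :: "nat \<Rightarrow> (nat \<Rightarrow> real) set"
    and f :: "(nat \<Rightarrow> real) \<Rightarrow> real" and x :: "nat \<Rightarrow> real"
  assumes prob: "prob_space M"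
    and partition: "block_partition d K \<pi>"
    and rv: "\<And>i. i \<in> {1..d} \<Longrightarrow> X i \<in> borel_measurable M"
    and blocks_indep:
      "prob_space.indep_vars M (\<lambda>k. PiM (\<pi> k) (\<lambda>_. borel)) (\<lambda>k. rvec (\<pi> k) X) {1..K}"
    and block1_indep: "prob_space.indep_vars M (\<lambda>_. borel) X (\<pi> 1)"
    and block_dep:
      "\<And>k. k \<in> {2..K} \<Longrightarrow> \<not> prob_space.indep_vars M (\<lambda>_. borel) X (\<pi> k)"
    and explanatory: "\<And>k. k \<in> {2..K} \<Longrightarrow> e k \<in> \<pi> k"
    and Z_indep:
      "\<And>k. k \<in> {2..K} \<Longrightarrow> prob_space.indep_vars M (\<lambda>_. borel) (Z k) {1..<card (\<pi> k)}"
    and Z_indep_X: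
      "\<And>k. k \<in> {2..K} \<Longrightarrow>
         prob_space.indep_var M (PiM {e k} (\<lambda>_. borel)) (rvec {e k} X)
           (PiM {1..<card (\<pi> k)} (\<lambda>_. borel)) (rvec {1..<card (\<pi> k)} (Z k))"
    and Z_values: "\<And>k. k \<in> {2..K} \<Longrightarrow> D k = rvec {1..<card (\<pi> k)} (Z k) ` space M"
    and dependency_model:
      "\<And>k \<omega>. k \<in> {2..K} \<Longrightarrow> \<omega> \<in> space M \<Longrightarrow>
         rvec (\<pi> k - {e k}) X \<omega> =
           dep_fun \<pi> e r k (X (e k) \<omega>) (rvec {1..<card (\<pi> k)} (Z k) \<omega>)"
    and invertible:
      "\<And>k t. k \<in> {2..K} \<Longrightarrow> t \<in> X (e k) ` space M \<Longrightarrow> inj_on (dep_fun \<pi> e r k t) (D k)"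
    and sample: "x \<in> rvec {1..d} X ` space M"
    and A2_joint: "continuous_cdf_pos_density M {1..d} X"
    and A2_marginal: "\<And>i. i \<in> {1..d} \<Longrightarrow> continuous_cdf_pos_density M {i} X"
    and A3:
      "\<And>k i t z. k \<in> {2..K} \<Longrightarrow> i \<in> \<pi> k - {e k} \<Longrightarrow> t \<in> X (e k) ` space M \<Longrightarrow> z \<in> D k \<Longrightarrow>
         (\<lambda>s. r i s z) differentiable (at t)"
    and A4:
      "\<And>y i. y \<in> {1..d} \<rightarrow>\<^sub>E UNIV \<Longrightarrow> i \<in> {1..d} \<Longrightarrow>
         (\<lambda>s. f (y(i := s))) differentiable (at (y i))"
  shows "(\<forall>k\<in>{2..K}. actual_jacobian_block K \<pi> e r D x k = Ja_block \<pi> e r D x k) \<and>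
         actual_jacobian d K \<pi> e r D x = Ja K \<pi> e r D x \<and>
         actual_gradient d K \<pi> e r D f x =
           transpose_mat (Ja K \<pi> e r D x) *\<^sub>v formal_gradient d K \<pi> f x"
  \<comment> \<open>The third claim is the transposed-Jacobian formula for the gradient with the
    Jacobian replaced by its closed form from the second claim.\<close>
  using actual_jacobian_block_eq_Ja_block[OF partition] actual_jacobian_eq_Ja[OF partition]
    actual_gradient_eq[OF partition]
  by metis

end
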